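(* Let $d\ge 1$ be an integer, $\phi:\{-1,1\}^d\to\{-1,1\}$ a map, $E_d=\{-1,1\}^d$, $\varepsilon=(\varepsilon_n)_{n\in\mathbf{Z}}$ a coin-tossing sequence, and $H_n=\phi(\varepsilon_{n-d},\dots,\varepsilon_{n-1})$ for all $n\in\mathbf{Z}$. The following are equivalent: (1) $\mathcal{F}_\infty^{H\varepsilon}=\mathcal{F}_\infty^{\varepsilon}$; (2) all elements of $E_d$ are pairwise accordable; (3) all elements of $E_d$ are simultaneously accordable.
   Context: A coin-tossing sequence is a family of independent random variables, each of law $(\delta_{-1}+\delta_1)/2$. $\mathcal{F}_\infty^{\varepsilon}=\sigma((\varepsilon_n)_{n\in\mathbf{Z}})$, $\mathcal{F}_\infty^{H\varepsilon}=\sigma((H_n\varepsilon_n)_{n\in\mathbf{Z}})$, both completed. For $\alpha\in\{-1,1\}$, $f_\alpha:E_d\to E_d$ is defined by $f_\alpha(x_1,\dots,x_d)=(x_2,\dots,x_d,\alpha\,\phi(x_1,\dots,x_d))$. Elements $a,b\in E_d$ are accordable if there is a finite sequence of signs $\alpha_1,\dots,\alpha_l\in\{-1,1\}$ such that $f_{\alpha_l}\circ\cdots\circ f_{\alpha_1}$ takes the same value at $a$ and $b$. Elements $a_1,\dots,a_m\in E_d$ are simultaneously accordable if there is a finite sequence of signs $\alpha_1,\dots,\alpha_l$ such that $f_{\alpha_l}\circ\cdots\circ f_{\alpha_1}$ takes the same value at $a_1,\dots,a_m$. *)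

theory Defs
  imports "HOL-Probability.Probability"
begin

definition signs :: "int set" where
  "signs = {-1, 1}"

definition E :: "nat \<Rightarrow> int list set" where
  "E d = {x. length x = d \<and> set x \<subseteq> signs}"

text \<open>Each variable is measurable into the two-point space, so it takes the values
  \<open>-1\<close> and \<open>1\<close> everywhere and not only almost surely; the uniform measure on
  \<open>{-1, 1}\<close> is half the sum of the two Dirac masses.\<close>

definition coin_tossing :: "'a measure \<Rightarrow> ('i \<Rightarrow> 'a \<Rightarrow> int) \<Rightarrow> bool" where
  "coin_tossing M X \<longleftrightarrow>
     prob_space.indep_vars M (\<lambda>_. count_space signs) X UNIV \<and>
     (\<forall>i. distr M (count_space signs) (X i) = uniform_count_measure signs)"

text \<open>The generated sigma-field is enlarged by all null sets of the completed ambient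
  space, that is, by all subsets of the null sets of \<open>M\<close>; \<open>M\<close> itself
  need not be complete.\<close>

definition completed_sigma_field ::
  "'a measure \<Rightarrow> 'b measure \<Rightarrow> ('i \<Rightarrow> 'a \<Rightarrow> 'b) \<Rightarrow> 'a set set" where
  "completed_sigma_field M N X =
     sigma_sets (space M)
       ((\<Union>i. {X i -` A \<inter> space M | A. A \<in> sets N}) \<union> null_sets (completion M))"

definition predictor ::
  "nat \<Rightarrow> (int list \<Rightarrow> int) \<Rightarrow> (int \<Rightarrow> 'a \<Rightarrow> int) \<Rightarrow> int \<Rightarrow> 'a \<Rightarrow> int" where
  "predictor d \<phi> \<epsilon> n \<omega> = \<phi> (map (\<lambda>k. \<epsilon> (n - int d + int k) \<omega>) [0..<d])"

definition shift_map :: "(int list \<Rightarrow> int) \<Rightarrow> int \<Rightarrow> int list \<Rightarrow> int list" where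
  "shift_map \<phi> \<alpha> x = tl x @ [\<alpha> * \<phi> x]"

text \<open>\<open>fold\<close> applies the map of the first sign first, so
  \<open>fold (shift_map \<phi>) [\<alpha>\<^sub>1, \<dots>, \<alpha>\<^sub>l]\<close> is
  the composition \<open>f\<^bsub>\<alpha>\<^sub>l\<^esub> \<circ> \<dots> \<circ> f\<^bsub>\<alpha>\<^sub>1\<^esub>\<close>.\<close>

definition accordable :: "(int list \<Rightarrow> int) \<Rightarrow> int list \<Rightarrow> int list \<Rightarrow> bool" where
  "accordable \<phi> a b \<longleftrightarrow>
     (\<exists>\<alpha>s. set \<alpha>s \<subseteq> signs \<and> fold (shift_map \<phi>) \<alpha>s a = fold (shift_map \<phi>) \<alpha>s b)"

definition simultaneously_accordable :: "(int list \<Rightarrow> int) \<Rightarrow> int list set \<Rightarrow> bool" where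
  "simultaneously_accordable \<phi> A \<longleftrightarrow>
     (\<exists>\<alpha>s. set \<alpha>s \<subseteq> signs \<and>
       (\<forall>a\<in>A. \<forall>b\<in>A. fold (shift_map \<phi>) \<alpha>s a = fold (shift_map \<phi>) \<alpha>s b))"

end

theory Submission
  imports Defs
begin

text \<open>Call \<open>H\<^sub>n \<epsilon>\<^sub>n\<close> the innovation at time \<open>n\<close> and the last \<open>d\<close> coins the state.
  Since \<open>H\<^sub>n\<close> is a sign, \<open>\<epsilon>\<^sub>n = (H\<^sub>n \<epsilon>\<^sub>n) \<phi>(\<epsilon>\<^bsub>n-d\<^esub>, \<dots>, \<epsilon>\<^bsub>n-1\<^esub>)\<close>, so the innovations drive
  the state through the shift maps (\<open>state_conv_fold_innovations\<close>).  A state together with the word of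
  the \<open>L\<close> innovations that follow is the same information as \<open>d + L\<close> consecutive coins; each such pair
  therefore has probability \<open>1 / 2 ^ (d + L)\<close> (\<open>start_event_prob\<close>).  This single fact contains all
  the probability that is needed: the innovations are fair coins, independent of the earlier state.

  Pairwise accordability gives a synchronizing word, one whose map is constant on \<open>E d\<close>, by merging
  the states one after the other (\<open>pairwise_imp_simultaneously_accordable\<close>).  Almost surely the
  innovations spell a synchronizing word in the past of any given time, and from then on they
  determine the coins (\<open>coin_measurable_innovations\<close>).

  Conversely, if two states \<open>a\<close> and \<open>b\<close> are not accordable, then no word of innovations tells whether
  the state was \<open>a\<close> or \<open>b\<close> before the word, and the two cases lead to different present states.  So a
  function of finitely many innovations misses the present state with probability at least
  \<open>1 / 2 ^ d\<close>.  Every event of the completed sigma-field of the innovations is, however, a limit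
  in probability of events that depend on finitely many of them
  (\<open>completed_sigma_field_approximation\<close>), so the sigma-field cannot contain all events of the present
  state (\<open>accordable_if_states_measurable\<close>).\<close>

section \<open>Sign words and the maps they induce\<close>

lemma finite_E: "finite (E n)"
  and card_E: "card (E n) = 2 ^ n"
proof -
  have eq: "E n = {xs. set xs \<subseteq> signs \<and> length xs = n}"
    by (auto simp: E_def)
  have "finite signs" "card signs = 2"
    by (auto simp: signs_def)
  then show "finite (E n)" "card (E n) = 2 ^ n"
    unfolding eq by (auto simp: finite_lists_length_eq card_lists_length_eq)
qed

lemma sign_mult: "s \<in> signs \<Longrightarrow> t \<in> signs \<Longrightarrow> s * t \<in> signs"
  by (auto simp: signs_def)

lemma sign_mult_eq_iff: "s \<in> signs \<Longrightarrow> s * t = r \<longleftrightarrow> t = r * s"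
  by (auto simp: signs_def)

lemma shift_map_E:
  assumes "\<phi> \<in> E d \<rightarrow> signs" "d \<ge> 1" "x \<in> E d" "\<alpha> \<in> signs"
  shows "shift_map \<phi> \<alpha> x \<in> E d"
proof -
  have "x \<noteq> []" using assms by (auto simp: E_def)
  moreover have "\<alpha> * \<phi> x \<in> signs"
    using assms by (intro sign_mult) auto
  ultimately show ?thesis
    using assms by (cases x) (auto simp: E_def shift_map_def)
qed

lemma fold_shift_map_E:
  assumes "\<phi> \<in> E d \<rightarrow> signs" "d \<ge> 1" "x \<in> E d" "set w \<subseteq> signs"
  shows "fold (shift_map \<phi>) w x \<in> E d"
  using assms(3,4) by (induction w arbitrary: x) (auto intro: shift_map_E[OF assms(1,2)])

definition synchronizing :: "nat \<Rightarrow> (int list \<Rightarrow> int) \<Rightarrow> int list \<Rightarrow> bool" where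
  "synchronizing d \<phi> w \<longleftrightarrow>
     (\<forall>a\<in>E d. \<forall>b\<in>E d. fold (shift_map \<phi>) w a = fold (shift_map \<phi>) w b)"

lemma synchronizing_append:
  assumes "\<phi> \<in> E d \<rightarrow> signs" "d \<ge> 1" "set u \<subseteq> signs"
    and "synchronizing d \<phi> u \<or> synchronizing d \<phi> v"
  shows "synchronizing d \<phi> (u @ v)"
  unfolding synchronizing_def
proof (intro ballI)
  fix a b assume ab: "a \<in> E d" "b \<in> E d"
  have "fold (shift_map \<phi>) u a \<in> E d" "fold (shift_map \<phi>) u b \<in> E d"
    using ab by (auto intro: fold_shift_map_E[OF assms(1,2) _ assms(3)])
  then show "fold (shift_map \<phi>) (u @ v) a = fold (shift_map \<phi>) (u @ v) b"
    using assms(4) ab unfolding synchronizing_def by (metis comp_apply fold_append)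
qed

text \<open>Points are merged one at a time: a word that has already sent a set to one point is
  prolonged by a word that merges this point with the image of the next element.  Points
  that have met never separate again.\<close>

lemma pairwise_imp_simultaneously_accordable:
  assumes \<phi>: "\<phi> \<in> E d \<rightarrow> signs" and d: "d \<ge> 1"
    and pairwise: "\<forall>a\<in>E d. \<forall>b\<in>E d. accordable \<phi> a b"
  shows "simultaneously_accordable \<phi> (E d)"
proof -
  let ?F = "fold (shift_map \<phi>)"
  have "\<exists>\<alpha>s. set \<alpha>s \<subseteq> signs \<and> (\<forall>a\<in>A. \<forall>b\<in>A. ?F \<alpha>s a = ?F \<alpha>s b)"
    if "finite A" "A \<subseteq> E d" for A
    using that
  proof (induction A rule: finite_induct)
    case empty
    show ?case by (rule exI[of _ "[]"]) simp
  next
    case (insert x A)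
    then obtain u where u: "set u \<subseteq> signs" "\<And>a b. a \<in> A \<Longrightarrow> b \<in> A \<Longrightarrow> ?F u a = ?F u b"
      by blast
    show ?case
    proof (cases "A = {}")
      case True
      then show ?thesis by (intro exI[of _ "[]"]) simp
    next
      case False
      then obtain y where y: "y \<in> A" by auto
      have "?F u x \<in> E d" "?F u y \<in> E d"
        using insert.prems y by (auto intro!: fold_shift_map_E[OF \<phi> d _ u(1)])
      then have "accordable \<phi> (?F u x) (?F u y)"
        using pairwise by blast
      then obtain v where v: "set v \<subseteq> signs" "?F v (?F u x) = ?F v (?F u y)"
        unfolding accordable_def by blast
      have "?F (u @ v) a = ?F v (?F u y)" if "a \<in> insert x A" for a
        using that v(2) u(2)[OF _ y] by auto
      then show ?thesis
        using u(1) v(1) by (intro exI[of _ "u @ v"]) auto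
    qed
  qed
  from this[OF finite_E order_refl] show ?thesis
    unfolding simultaneously_accordable_def .
qed

text \<open>Prolonging a synchronizing word on either side leaves it synchronizing.  So a word that is not
  synchronizing differs from \<open>w\<close> in each of its \<open>k\<close> consecutive blocks of length \<open>l\<close>, which leaves
  \<open>2 ^ l - 1\<close> choices per block.  The proportion of such words thus decays geometrically.\<close>

lemma card_not_synchronizing_le:
  assumes \<phi>: "\<phi> \<in> E d \<rightarrow> signs" and d: "d \<ge> 1"
    and w: "w \<in> E l" "synchronizing d \<phi> w"
  shows "card {u \<in> E (k * l). \<not> synchronizing d \<phi> u} \<le> (2 ^ l - 1) ^ k"
proof (induction k)
  case 0
  have "{u \<in> E (0 * l). \<not> synchronizing d \<phi> u} \<subseteq> {[]}"
    by (auto simp: E_def)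
  then have "card {u \<in> E (0 * l). \<not> synchronizing d \<phi> u} \<le> card {[] :: int list}"
    by (intro card_mono) auto
  then show ?case by simp
next
  case (Suc k)
  let ?B = "\<lambda>k. {u \<in> E (k * l). \<not> synchronizing d \<phi> u}"
  have "?B (Suc k) \<subseteq> (\<lambda>(u, v). u @ v) ` (?B k \<times> (E l - {w}))"
  proof
    fix z assume z: "z \<in> ?B (Suc k)"
    define u v where "u = take (k * l) z" and "v = drop (k * l) z"
    have zuv: "z = u @ v" by (simp add: u_def v_def)
    have len: "length u = k * l" "length v = l"
      using z by (auto simp: u_def v_def E_def)
    have sg: "set u \<subseteq> signs" "set v \<subseteq> signs"
      using z unfolding zuv by (auto simp: E_def)
    have "\<not> synchronizing d \<phi> u" "\<not> synchronizing d \<phi> v"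
      using z synchronizing_append[OF \<phi> d sg(1)] unfolding zuv by auto
    then show "z \<in> (\<lambda>(u, v). u @ v) ` (?B k \<times> (E l - {w}))"
      using len sg w unfolding zuv by (auto simp: E_def)
  qed
  moreover have fin: "finite (?B k \<times> (E l - {w}))"
    by (intro finite_cartesian_product) (auto intro: finite_subset[OF _ finite_E])
  ultimately have "card (?B (Suc k)) \<le> card ((\<lambda>(u, v). u @ v) ` (?B k \<times> (E l - {w})))"
    by (intro card_mono finite_imageI)
  also have "\<dots> \<le> card (?B k \<times> (E l - {w}))"
    by (rule card_image_le[OF fin])
  also have "\<dots> = card (?B k) * (2 ^ l - 1)"
    using w by (simp add: card_cartesian_product card_E finite_E)
  also have "\<dots> \<le> (2 ^ l - 1) ^ k * (2 ^ l - 1)"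
    using Suc.IH by (intro mult_right_mono) auto
  finally show ?case by (simp add: mult.commute)
qed

section \<open>Segments of a process\<close>

definition segment :: "(int \<Rightarrow> 'a \<Rightarrow> 'b) \<Rightarrow> int \<Rightarrow> nat \<Rightarrow> 'a \<Rightarrow> 'b list" where
  "segment Y m L \<omega> = map (\<lambda>k. Y (m + int k) \<omega>) [0..<L]"

lemma length_segment [simp]: "length (segment Y m L \<omega>) = L"
  by (simp add: segment_def)

lemma segment_0 [simp]: "segment Y m 0 \<omega> = []"
  by (simp add: segment_def)

lemma segment_Suc: "segment Y m (Suc L) \<omega> = segment Y m L \<omega> @ [Y (m + int L) \<omega>]"
  by (simp add: segment_def)

lemma segment_Suc_left: "segment Y m (Suc L) \<omega> = Y m \<omega> # segment Y (m + 1) L \<omega>"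
  by (induction L) (auto simp: segment_Suc algebra_simps)

lemma segment_add:
  "segment Y m (K + L) \<omega> = segment Y m K \<omega> @ segment Y (m + int K) L \<omega>"
  by (induction L) (auto simp: segment_Suc algebra_simps)

lemma segment_eq_iff:
  "segment Y m L \<omega> = w \<longleftrightarrow> length w = L \<and> (\<forall>k<L. Y (m + int k) \<omega> = w ! k)"
  by (auto simp: segment_def list_eq_iff_nth_eq)

lemma segment_in_E:
  assumes "\<And>i. Y i \<omega> \<in> signs"
  shows "segment Y m L \<omega> \<in> E L"
  using assms by (auto simp: E_def segment_def)

lemma segment_event_measurable:
  assumes Y: "\<And>i. Y i \<in> measurable F (count_space signs)"
  shows "{\<omega> \<in> space F. P (segment Y m L \<omega>)} \<in> sets F"
proof (induction L arbitrary: P)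
  case 0
  then show ?case by (cases "P []") auto
next
  case (Suc L)
  have Ysig: "Y i \<omega> \<in> signs" if "\<omega> \<in> space F" for i \<omega>
    using measurable_space[OF Y that] by simp
  have "{\<omega> \<in> space F. P (segment Y m (Suc L) \<omega>)} =
    (\<Union>s\<in>signs. {\<omega> \<in> space F. P (segment Y m L \<omega> @ [s])} \<inter> (Y (m + int L) -` {s} \<inter> space F))"
    using Ysig by (auto simp: segment_Suc)
  also have "\<dots> \<in> sets F"
    by (intro sets.finite_UN sets.Int Suc.IH measurable_sets[OF Y]) (auto simp: signs_def)
  finally show ?case .
qed

section \<open>Completed sigma-fields\<close>

text \<open>The completed sigma-field is packaged as a measure space in order to speak of functions that are
  measurable with respect to it.\<close>

definition completed_sigma :: "'a measure \<Rightarrow> 'b measure \<Rightarrow> ('i \<Rightarrow> 'a \<Rightarrow> 'b) \<Rightarrow> 'a measure" where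
  "completed_sigma M N X =
     sigma (space M) ((\<Union>i. {X i -` A \<inter> space M | A. A \<in> sets N}) \<union> null_sets (completion M))"

lemma space_completed_sigma [simp]: "space (completed_sigma M N X) = space M"
  and sets_completed_sigma: "sets (completed_sigma M N X) = completed_sigma_field M N X"
proof -
  have "(\<Union>i. {X i -` A \<inter> space M | A. A \<in> sets N}) \<union> null_sets (completion M) \<subseteq> Pow (space M)"
    using sets.sets_into_space[of _ "completion M"] by auto
  then show "space (completed_sigma M N X) = space M"
    "sets (completed_sigma M N X) = completed_sigma_field M N X"
    by (simp_all add: completed_sigma_def completed_sigma_field_def sets_measure_of)
qed

lemma null_sets_in_completed_sigma:
  "A \<in> null_sets M \<Longrightarrow> A \<in> sets (completed_sigma M N X)"
  unfolding sets_completed_sigma completed_sigma_field_def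
  by (intro sigma_sets.Basic) (auto intro: null_sets_completionI)

lemma measurable_completed_sigma:
  assumes "X i \<in> measurable M N"
  shows "X i \<in> measurable (completed_sigma M N X) N"
proof (rule measurableI)
  fix A assume "A \<in> sets N"
  then show "X i -` A \<inter> space (completed_sigma M N X) \<in> sets (completed_sigma M N X)"
    unfolding sets_completed_sigma completed_sigma_field_def space_completed_sigma
    by (intro sigma_sets.Basic) auto
qed (use measurable_space[OF assms] in auto)

lemma completed_sigma_field_subset:
  assumes "\<And>j. Y j \<in> measurable (completed_sigma M N X) N"
  shows "completed_sigma_field M N Y \<subseteq> completed_sigma_field M N X"
proof -
  have "(\<Union>i. {Y i -` A \<inter> space M | A. A \<in> sets N}) \<union> null_sets (completion M)
    \<subseteq> sets (completed_sigma M N X)"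
  proof (intro Un_least UN_least subsetI)
    fix i B assume "B \<in> {Y i -` A \<inter> space M | A. A \<in> sets N}"
    then show "B \<in> sets (completed_sigma M N X)"
      using measurable_sets[OF assms] by auto
  next
    fix B assume "B \<in> null_sets (completion M)"
    then show "B \<in> sets (completed_sigma M N X)"
      unfolding sets_completed_sigma completed_sigma_field_def
      by (intro sigma_sets.Basic) auto
  qed
  from sets.sigma_sets_subset[OF this] show ?thesis
    by (simp add: completed_sigma_field_def[of M N Y] sets_completed_sigma)
qed

section \<open>Approximation by events that depend on finitely many times\<close>

text \<open>Events determined by the values of the process at the times \<open>- N, \<dots>, N - 1\<close>.  One implication
  suffices in the definition, since agreement on the window is symmetric.\<close>

definition window_event :: "'a measure \<Rightarrow> (int \<Rightarrow> 'a \<Rightarrow> 'b) \<Rightarrow> nat \<Rightarrow> 'a set \<Rightarrow> bool" where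
  "window_event M Y N B \<longleftrightarrow> B \<in> sets M \<and>
     (\<forall>\<omega>\<in>B. \<forall>\<omega>'\<in>space M.
        (\<forall>i. - int N \<le> i \<and> i < int N \<longrightarrow> Y i \<omega> = Y i \<omega>') \<longrightarrow> \<omega>' \<in> B)"

lemma window_event_mono: "window_event M Y N B \<Longrightarrow> N \<le> N' \<Longrightarrow> window_event M Y N' B"
  unfolding window_event_def by (smt (verit) of_nat_mono)

lemma window_event_Compl:
  assumes "window_event M Y N B"
  shows "window_event M Y N (space M - B)"
  unfolding window_event_def
proof (intro conjI ballI impI)
  show "space M - B \<in> sets M"
    using assms by (auto simp: window_event_def)
  fix \<omega> \<omega>' assume *: "\<omega> \<in> space M - B" "\<omega>' \<in> space M"
    "\<forall>i. - int N \<le> i \<and> i < int N \<longrightarrow> Y i \<omega> = Y i \<omega>'"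
  have "\<omega> \<in> B" if "\<omega>' \<in> B"
  proof -
    have "\<forall>i. - int N \<le> i \<and> i < int N \<longrightarrow> Y i \<omega>' = Y i \<omega>"
      using *(3) by simp
    then show ?thesis
      using assms that *(1) unfolding window_event_def by blast
  qed
  then show "\<omega>' \<in> space M - B" using * by blast
qed

lemma window_event_finite_UN:
  assumes "finite I" "\<And>i. i \<in> I \<Longrightarrow> window_event M Y N (B i)"
  shows "window_event M Y N (\<Union>i\<in>I. B i)"
  unfolding window_event_def
proof (intro conjI ballI impI)
  show "(\<Union>i\<in>I. B i) \<in> sets M"
    using assms by (intro sets.finite_UN) (auto simp: window_event_def)
  fix \<omega> \<omega>' assume *: "\<omega> \<in> (\<Union>i\<in>I. B i)" "\<omega>' \<in> space M"
    "\<forall>i. - int N \<le> i \<and> i < int N \<longrightarrow> Y i \<omega> = Y i \<omega>'"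
  then obtain i where i: "i \<in> I" "\<omega> \<in> B i" by blast
  have "\<omega>' \<in> B i"
    using assms(2)[OF i(1)] i(2) *(2,3) unfolding window_event_def by blast
  then show "\<omega>' \<in> (\<Union>i\<in>I. B i)" using i(1) by blast
qed

text \<open>The approximable sets form a sigma-field.  Since null sets of the completion need not be
  measurable, the error is controlled by a measurable set \<open>D\<close> that contains it.  For a countable
  union the errors are summed geometrically, and the tail of the union of the approximating events
  is dropped by continuity of the measure.\<close>

lemma (in prob_space) completed_sigma_field_approximation:
  fixes Y :: "int \<Rightarrow> 'a \<Rightarrow> 'b"
  assumes Y: "\<And>i. Y i \<in> measurable M K"
    and A: "A \<in> completed_sigma_field M K Y" and "\<delta> > 0"
  shows "\<exists>N B D. window_event M Y N B \<and> D \<in> sets M \<and> prob D < \<delta> \<and> A - B \<subseteq> D \<and> B - A \<subseteq> D"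
  using A[unfolded completed_sigma_field_def] \<open>\<delta> > 0\<close>
proof (induction arbitrary: \<delta> rule: sigma_sets.induct)
  case (Basic A)
  then consider i C where "C \<in> sets K" "A = Y i -` C \<inter> space M" | "A \<in> null_sets (completion M)"
    by auto
  then show ?case
  proof cases
    case (1 i C)
    have "window_event M Y (nat \<bar>i\<bar> + 1) A"
      unfolding window_event_def
    proof (intro conjI ballI impI)
      show "A \<in> sets M"
        using 1 measurable_sets[OF Y] by auto
      fix \<omega> \<omega>' assume *: "\<omega> \<in> A" "\<omega>' \<in> space M"
        "\<forall>j. - int (nat \<bar>i\<bar> + 1) \<le> j \<and> j < int (nat \<bar>i\<bar> + 1) \<longrightarrow> Y j \<omega> = Y j \<omega>'"
      have "- int (nat \<bar>i\<bar> + 1) \<le> i \<and> i < int (nat \<bar>i\<bar> + 1)" by linarith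
      with *(3) have "Y i \<omega> = Y i \<omega>'" by blast
      then show "\<omega>' \<in> A" using * 1 by auto
    qed
    then show ?thesis
      using Basic.prems by (intro exI[of _ "nat \<bar>i\<bar> + 1"] exI[of _ A] exI[of _ "{}"]) auto
  next
    case 2
    then obtain D where D: "D \<in> null_sets M" "A \<subseteq> D"
      unfolding null_sets_completion_iff2 by blast
    then have "D \<in> sets M" "prob D < \<delta>"
      using Basic.prems by (simp_all add: null_sets_def measure_def)
    then show ?thesis
      using D(2) by (intro exI[of _ 0] exI[of _ "{}"] exI[of _ D]) (simp add: window_event_def)
  qed
next
  case Empty
  then show ?case
    by (intro exI[of _ 0] exI[of _ "{}"]) (auto simp: window_event_def)
next
  case (Compl A)
  then obtain N B D where *: "window_event M Y N B" "D \<in> sets M" "prob D < \<delta>"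
    "A - B \<subseteq> D" "B - A \<subseteq> D" by blast
  then show ?case
    by (intro exI[of _ N] exI[of _ "space M - B"] exI[of _ D] conjI window_event_Compl)
       (auto simp: window_event_def dest: sets.sets_into_space)
next
  case (Union A)
  have "\<exists>N B D. window_event M Y N B \<and> D \<in> sets M \<and> prob D < \<delta> / 2 * (1/2) ^ Suc i \<and>
          A i - B \<subseteq> D \<and> B - A i \<subseteq> D" for i
    using Union.IH[of "\<delta> / 2 * (1/2) ^ Suc i" i] Union.prems by simp
  then obtain N B D where *: "\<And>i. window_event M Y (N i) (B i)" "\<And>i. D i \<in> sets M"
    "\<And>i. prob (D i) < \<delta> / 2 * (1/2) ^ Suc i"
    "\<And>i. A i - B i \<subseteq> D i" "\<And>i. B i - A i \<subseteq> D i" by metis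
  have B: "B i \<in> sets M" for i
    using *(1) by (auto simp: window_event_def)
  have geometric: "(\<lambda>i. \<delta> / 2 * (1/2) ^ Suc i) sums (\<delta> / 2)"
    using sums_mult[OF power_half_series, of "\<delta> / 2"] by simp
  have summable: "summable (\<lambda>i. prob (D i))"
    by (rule summable_comparison_test'[OF sums_summable[OF geometric], of 0])
       (use *(3) in \<open>auto intro: less_imp_le\<close>)
  have "prob (\<Union>i. D i) \<le> (\<Sum>i. prob (D i))"
    using *(2) summable by (intro finite_measure_subadditive_countably) auto
  also have "\<dots> \<le> (\<Sum>i. \<delta> / 2 * (1/2) ^ Suc i)"
    using *(3) by (intro suminf_le summable sums_summable[OF geometric]) (auto intro: less_imp_le)
  also have "\<dots> = \<delta> / 2"
    using sums_unique[OF geometric] by simp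
  finally have PD: "prob (\<Union>i. D i) \<le> \<delta> / 2" .
  have "(\<lambda>k. prob (\<Union>i<k. B i)) \<longlonglongrightarrow> prob (\<Union>k. \<Union>i<k. B i)"
  proof (rule finite_Lim_measure_incseq)
    show "incseq (\<lambda>k. \<Union>i<k. B i)"
      by (intro monoI UN_mono) auto
  qed (use B in auto)
  also have "(\<Union>k. \<Union>i<k. B i) = (\<Union>i. B i)"
    by auto
  finally have "eventually (\<lambda>k. prob (\<Union>i<k. B i) > prob (\<Union>i. B i) - \<delta> / 2) sequentially"
    using Union.prems by (intro order_tendstoD) auto
  then obtain k where k: "prob (\<Union>i<k. B i) > prob (\<Union>i. B i) - \<delta> / 2"
    by (auto simp: eventually_sequentially)
  define T where "T = (\<Union>i. B i) - (\<Union>i<k. B i)"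
  have T: "T \<in> sets M" using B by (auto simp: T_def)
  have "prob T = prob (\<Union>i. B i) - prob (\<Union>i<k. B i)"
    unfolding T_def using B by (intro finite_measure_Diff) auto
  then have PT: "prob T < \<delta> / 2" using k by simp
  have "prob ((\<Union>i. D i) \<union> T) \<le> prob (\<Union>i. D i) + prob T"
    using *(2) T by (intro measure_Un_le) auto
  then have P: "prob ((\<Union>i. D i) \<union> T) < \<delta>" using PD PT by simp
  have "window_event M Y (\<Sum>i<k. N i) (\<Union>i<k. B i)"
  proof (intro window_event_finite_UN)
    fix i assume "i \<in> {..<k}"
    then show "window_event M Y (\<Sum>i<k. N i) (B i)"
      by (intro window_event_mono[OF *(1)] member_le_sum) auto
  qed auto
  moreover have "(\<Union>i. A i) - (\<Union>i<k. B i) \<subseteq> (\<Union>i. D i) \<union> T"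
    using *(4) unfolding T_def by blast
  moreover have "(\<Union>i<k. B i) - (\<Union>i. A i) \<subseteq> (\<Union>i. D i) \<union> T"
    using *(5) by blast
  moreover have "(\<Union>i. D i) \<union> T \<in> sets M"
    using *(2) T by auto
  ultimately show ?case using P by blast
qed

section \<open>The process driven by its innovations\<close>

locale predicted_coin_tossing = prob_space M for M :: "'a measure" +
  fixes d :: nat and \<phi> :: "int list \<Rightarrow> int" and \<epsilon> :: "int \<Rightarrow> 'a \<Rightarrow> int"
  assumes d: "d \<ge> 1" and \<phi>: "\<phi> \<in> E d \<rightarrow> signs" and coin: "coin_tossing M \<epsilon>"
begin

definition innovation :: "int \<Rightarrow> 'a \<Rightarrow> int" where
  "innovation n \<omega> = predictor d \<phi> \<epsilon> n \<omega> * \<epsilon> n \<omega>"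

lemma innovation_eq: "innovation n \<omega> = \<phi> (segment \<epsilon> (n - int d) d \<omega>) * \<epsilon> n \<omega>"
  by (simp add: innovation_def predictor_def segment_def)

lemma measurable_coin: "\<epsilon> i \<in> measurable M (count_space signs)"
  using coin by (auto simp: coin_tossing_def indep_vars_def)

lemma coin_in_signs: "\<omega> \<in> space M \<Longrightarrow> \<epsilon> i \<omega> \<in> signs"
  using measurable_space[OF measurable_coin] by auto

lemma state_in_E: "\<omega> \<in> space M \<Longrightarrow> segment \<epsilon> m L \<omega> \<in> E L"
  by (intro segment_in_E coin_in_signs)

lemma prediction_in_signs: "\<omega> \<in> space M \<Longrightarrow> \<phi> (segment \<epsilon> m d \<omega>) \<in> signs"
  using \<phi> state_in_E by auto

lemma innovation_in_signs: "\<omega> \<in> space M \<Longrightarrow> innovation i \<omega> \<in> signs"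
  unfolding innovation_eq by (intro sign_mult prediction_in_signs coin_in_signs)

lemma innovations_in_E: "\<omega> \<in> space M \<Longrightarrow> segment innovation m L \<omega> \<in> E L"
  by (intro segment_in_E innovation_in_signs)

lemma coin_conv_innovation:
  assumes "\<omega> \<in> space M"
  shows "\<epsilon> (m + int d) \<omega> = innovation (m + int d) \<omega> * \<phi> (segment \<epsilon> m d \<omega>)"
  using sign_mult_eq_iff[OF prediction_in_signs[OF assms, of m]] innovation_eq[of "m + int d" \<omega>]
  by auto

text \<open>A sign is its own inverse, so each new coin is the innovation times the prediction.  The
  state, which consists of the last \<open>d\<close> coins, therefore moves by the shift map that the
  innovation selects.\<close>

lemma state_conv_fold_innovations:
  assumes "\<omega> \<in> space M"
  shows "segment \<epsilon> (m + int L) d \<omega> =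
    fold (shift_map \<phi>) (segment innovation (m + int d) L \<omega>) (segment \<epsilon> m d \<omega>)"
proof (induction L)
  case (Suc L)
  let ?m = "m + int L"
  obtain d' where d': "d = Suc d'" using d by (cases d) auto
  have "segment \<epsilon> (?m + 1) d \<omega> = tl (segment \<epsilon> ?m d \<omega>) @ [\<epsilon> (?m + int d) \<omega>]"
    unfolding d' segment_Suc_left[of \<epsilon> ?m] segment_Suc[of \<epsilon> "?m + 1"] by (simp add: algebra_simps)
  also have "\<dots> = shift_map \<phi> (innovation (?m + int d) \<omega>) (segment \<epsilon> ?m d \<omega>)"
    unfolding shift_map_def coin_conv_innovation[OF assms] ..
  also have "\<dots> = fold (shift_map \<phi>) (segment innovation (m + int d) (Suc L) \<omega>) (segment \<epsilon> m d \<omega>)"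
    by (simp add: Suc.IH segment_Suc algebra_simps)
  finally show ?case by (simp add: algebra_simps)
qed simp

lemma prob_coin_eq:
  assumes "s \<in> signs"
  shows "prob (\<epsilon> i -` {s} \<inter> space M) = 1 / 2"
proof -
  have "prob (\<epsilon> i -` {s} \<inter> space M) = measure (distr M (count_space signs) (\<epsilon> i)) {s}"
    using assms by (intro measure_distr[symmetric] measurable_coin) auto
  also have "\<dots> = measure (uniform_count_measure signs) {s}"
    using coin by (simp add: coin_tossing_def)
  also have "\<dots> = 1 / 2"
    using assms by (subst measure_uniform_count_measure) (auto simp: signs_def)
  finally show ?thesis .
qed

lemma prob_coin_segment:
  assumes "y \<in> E L"
  shows "prob {\<omega> \<in> space M. segment \<epsilon> m L \<omega> = y} = 1 / 2 ^ L"
proof (cases "L = 0")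
  case True
  then show ?thesis using assms by (simp add: E_def prob_space)
next
  case False
  let ?A = "\<lambda>i. {y ! nat (i - m)}" and ?J = "{m..<m + int L}"
  have sg: "y ! k \<in> signs" if "k < L" for k
    using assms that by (auto simp: E_def)
  have len: "length y = L" using assms by (simp add: E_def)
  have ball: "(\<forall>i\<in>?J. \<epsilon> i \<omega> = y ! nat (i - m)) \<longleftrightarrow> (\<forall>k<L. \<epsilon> (m + int k) \<omega> = y ! k)" for \<omega>
  proof safe
    fix k assume "\<forall>i\<in>?J. \<epsilon> i \<omega> = y ! nat (i - m)" "k < L"
    then show "\<epsilon> (m + int k) \<omega> = y ! k" by (auto dest: bspec[of _ _ "m + int k"])
  next
    fix i assume "\<forall>k<L. \<epsilon> (m + int k) \<omega> = y ! k" "i \<in> ?J"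
    then show "\<epsilon> i \<omega> = y ! nat (i - m)" by (auto dest: spec[of _ "nat (i - m)"])
  qed
  have J: "?J \<noteq> {}" using False by auto
  have "{\<omega> \<in> space M. segment \<epsilon> m L \<omega> = y} = (\<Inter>i\<in>?J. \<epsilon> i -` ?A i \<inter> space M)"
    using ball J unfolding segment_eq_iff by (auto simp: len)
  also have "prob \<dots> = (\<Prod>i\<in>?J. prob (\<epsilon> i -` ?A i \<inter> space M))"
    using coin J sg unfolding coin_tossing_def
    by (intro indep_varsD[where I = UNIV and M' = "\<lambda>_. count_space signs"]) auto
  also have "\<dots> = (\<Prod>i\<in>?J. 1 / 2)"
    using sg by (intro prod.cong refl prob_coin_eq) auto
  also have "\<dots> = 1 / 2 ^ L"
    by (simp add: power_divide)
  finally show ?thesis .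
qed

text \<open>Given the initial state, coins and innovations determine each other, so an initial state
  together with a word of innovations amounts to a word of coins.\<close>

lemma state_and_innovations_conv_coins:
  assumes x: "x \<in> E d" and w: "w \<in> E L"
  shows "\<exists>y\<in>E (d + L). \<forall>\<omega>\<in>space M.
    segment \<epsilon> m d \<omega> = x \<and> segment innovation (m + int d) L \<omega> = w \<longleftrightarrow> segment \<epsilon> m (d + L) \<omega> = y"
  using w
proof (induction L arbitrary: w)
  case 0
  then show ?case using x by (auto simp: E_def intro!: bexI[of _ x])
next
  case (Suc L)
  then obtain u s where w: "w = u @ [s]" and u: "u \<in> E L" and s: "s \<in> signs"
    by (cases w rule: rev_cases) (auto simp: E_def)
  from Suc.IH[OF u] obtain y where y: "y \<in> E (d + L)" and
    eqv: "\<And>\<omega>. \<omega> \<in> space M \<Longrightarrow> segment \<epsilon> m d \<omega> = x \<and> segment innovation (m + int d) L \<omega> = u \<longleftrightarrow>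
      segment \<epsilon> m (d + L) \<omega> = y" by blast
  let ?p = "\<phi> (fold (shift_map \<phi>) u x)"
  have "fold (shift_map \<phi>) u x \<in> E d"
    using u by (intro fold_shift_map_E[OF \<phi> d x]) (auto simp: E_def)
  then have p: "?p \<in> signs" using \<phi> by auto
  have yE: "y @ [s * ?p] \<in> E (d + Suc L)"
    using y sign_mult[OF s p] by (auto simp: E_def)
  have "segment \<epsilon> m d \<omega> = x \<and> segment innovation (m + int d) (Suc L) \<omega> = w \<longleftrightarrow>
      segment \<epsilon> m (d + Suc L) \<omega> = y @ [s * ?p]" if \<omega>: "\<omega> \<in> space M" for \<omega>
  proof -
    have "innovation (m + int d + int L) \<omega> = s \<longleftrightarrow> \<epsilon> (m + int (d + L)) \<omega> = s * ?p"
      if *: "segment \<epsilon> m d \<omega> = x" "segment innovation (m + int d) L \<omega> = u"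
    proof -
      have "innovation (m + int d + int L) \<omega> = ?p * \<epsilon> (m + int (d + L)) \<omega>"
        using state_conv_fold_innovations[OF \<omega>, of m L] * innovation_eq[of "m + int d + int L" \<omega>]
        by (simp add: algebra_simps)
      then show ?thesis using sign_mult_eq_iff[OF p] by auto
    qed
    then show ?thesis
      using eqv[OF \<omega>] by (auto simp: segment_Suc w)
  qed
  with yE show ?case by blast
qed

definition start_event :: "int \<Rightarrow> int list \<Rightarrow> int list \<Rightarrow> 'a set" where
  "start_event m x w =
     {\<omega> \<in> space M. segment \<epsilon> m d \<omega> = x \<and> segment innovation (m + int d) (length w) \<omega> = w}"

text \<open>Thus the state at any time is uniform and independent of the innovations that follow, which
  are themselves fair and independent.\<close>

lemma start_event_prob:
  assumes "x \<in> E d" "w \<in> E L"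
  shows "start_event m x w \<in> sets M" "prob (start_event m x w) = 1 / 2 ^ (d + L)"
proof -
  have L: "length w = L" using assms by (simp add: E_def)
  obtain y where y: "y \<in> E (d + L)" and
    eqv: "\<And>\<omega>. \<omega> \<in> space M \<Longrightarrow> segment \<epsilon> m d \<omega> = x \<and> segment innovation (m + int d) L \<omega> = w \<longleftrightarrow>
      segment \<epsilon> m (d + L) \<omega> = y"
    using state_and_innovations_conv_coins[OF assms] by blast
  have eq: "start_event m x w = {\<omega> \<in> space M. segment \<epsilon> m (d + L) \<omega> = y}"
    using eqv by (auto simp: start_event_def L)
  show "start_event m x w \<in> sets M"
    unfolding eq by (rule segment_event_measurable[OF measurable_coin])
  show "prob (start_event m x w) = 1 / 2 ^ (d + L)"
    unfolding eq by (rule prob_coin_segment[OF y])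
qed

lemma prob_innovations_le:
  assumes W: "W \<subseteq> E L"
  shows "prob {\<omega> \<in> space M. segment innovation n L \<omega> \<in> W} \<le> card W / 2 ^ L"
proof -
  let ?m = "n - int d"
  have fin: "finite W" using finite_subset[OF W finite_E] .
  have ev: "start_event ?m x w \<in> sets M" "prob (start_event ?m x w) = 1 / 2 ^ (d + L)"
    if "(x, w) \<in> E d \<times> W" for x w
    using start_event_prob that W by auto
  have len: "length w = L" if "w \<in> W" for w
    using W that by (auto simp: E_def)
  have "{\<omega> \<in> space M. segment innovation n L \<omega> \<in> W} = (\<Union>(x, w)\<in>E d \<times> W. start_event ?m x w)"
    using state_in_E by (auto simp: start_event_def len)
  then have "prob {\<omega> \<in> space M. segment innovation n L \<omega> \<in> W}
      \<le> (\<Sum>(x, w)\<in>E d \<times> W. prob (start_event ?m x w))"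
    using ev fin finite_E
      finite_measure_subadditive_finite[of "E d \<times> W" "\<lambda>(x, w). start_event ?m x w"]
    by (force simp: case_prod_unfold)
  also have "\<dots> = (\<Sum>(x, w)\<in>E d \<times> W. 1 / 2 ^ (d + L))"
    using ev by (intro sum.cong) auto
  also have "\<dots> = card W / 2 ^ L"
    by (simp add: card_cartesian_product card_E power_add)
  finally show ?thesis .
qed

lemma measurable_innovation:
  assumes F: "\<And>i. \<epsilon> i \<in> measurable F (count_space signs)" and sp: "space F = space M"
  shows "innovation n \<in> measurable F (count_space signs)"
proof -
  have "innovation n -` {s} \<inter> space F \<in> sets F" for s
  proof -
    \<comment> \<open>The innovation is a function of the coins at the \<open>d + 1\<close> times up to \<open>n\<close>: all but the last give
      the prediction.\<close>
    have "innovation n -` {s} \<inter> space F = {\<omega> \<in> space F.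
        \<phi> (butlast (segment \<epsilon> (n - int d) (Suc d) \<omega>)) * last (segment \<epsilon> (n - int d) (Suc d) \<omega>) = s}"
      by (auto simp: innovation_eq segment_Suc)
    also have "\<dots> \<in> sets F"
      by (rule segment_event_measurable[OF F])
    finally show ?thesis .
  qed
  then show "innovation n \<in> measurable F (count_space signs)"
    using innovation_in_signs sp
    by (subst measurable_count_space_eq2) (auto simp: signs_def)
qed

section \<open>Simultaneous accordability lets the innovations recover the coins\<close>

text \<open>When the innovations before time \<open>n + 1\<close> spell a synchronizing word, the state at time \<open>n\<close>,
  and hence the coin \<open>n\<close>, can be computed from any fictitious initial state.  By the geometric bound on
  the number of other words, such a past occurs almost surely.\<close>

lemma coin_measurable_innovations:
  assumes "simultaneously_accordable \<phi> (E d)"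
  shows "\<epsilon> n \<in> measurable (completed_sigma M (count_space signs) innovation) (count_space signs)"
proof -
  let ?F = "completed_sigma M (count_space signs) innovation"
  let ?sync = "synchronizing d \<phi>"
  obtain w where w: "set w \<subseteq> signs" "?sync w"
    using assms unfolding simultaneously_accordable_def synchronizing_def by blast
  define l where "l = length w"
  have wE: "w \<in> E l" using w by (simp add: E_def l_def)
  define past where "past k = segment innovation (n + 1 - int (k * l)) (k * l)" for k
  \<comment> \<open>An arbitrary state from which the decoding starts.\<close>
  define x0 where "x0 = replicate d (1::int)"
  have x0: "x0 \<in> E d" by (auto simp: x0_def E_def signs_def)
  have innM: "innovation i \<in> measurable M (count_space signs)" for i
    by (rule measurable_innovation[OF measurable_coin refl])
  have pastF: "{\<omega> \<in> space M. P (past k \<omega>)} \<in> sets ?F" for P k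
    using segment_event_measurable[OF measurable_completed_sigma[where X = innovation, OF innM],
        where P = P and m = "n + 1 - int (k * l)" and L = "k * l"]
    by (simp add: past_def)
  have pastM: "{\<omega> \<in> space M. P (past k \<omega>)} \<in> sets M" for P k
    unfolding past_def by (rule segment_event_measurable[OF innM])
  \<comment> \<open>The exceptional null set on which no past identifies the state.\<close>
  define Z where "Z = (\<Inter>k. {\<omega> \<in> space M. \<not> ?sync (past k \<omega>)})"
  have ZM: "Z \<in> sets M" unfolding Z_def by (intro sets.countable_INT) (auto intro: pastM)
  have Zle: "prob Z \<le> (1 - 1 / 2 ^ l) ^ k" for k
  proof -
    have "prob Z \<le> prob {\<omega> \<in> space M. \<not> ?sync (past k \<omega>)}"
      by (intro finite_measure_mono pastM) (auto simp: Z_def)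
    also have "{\<omega> \<in> space M. \<not> ?sync (past k \<omega>)} =
        {\<omega> \<in> space M. past k \<omega> \<in> {u \<in> E (k * l). \<not> ?sync u}}"
      using innovations_in_E by (auto simp: past_def)
    also have "prob \<dots> \<le> card {u \<in> E (k * l). \<not> ?sync u} / 2 ^ (k * l)"
      unfolding past_def by (intro prob_innovations_le) auto
    also have "\<dots> \<le> (2 ^ l - 1) ^ k / 2 ^ (k * l)"
    proof (intro divide_right_mono)
      have "real (card {u \<in> E (k * l). \<not> ?sync u}) \<le> real ((2 ^ l - 1) ^ k)"
        using card_not_synchronizing_le[OF \<phi> d wE w(2)] by (simp only: of_nat_le_iff)
      then show "real (card {u \<in> E (k * l). \<not> ?sync u}) \<le> (2 ^ l - 1) ^ k"
        by (simp add: of_nat_diff)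
    qed auto
    also have "\<dots> = (1 - 1 / 2 ^ l) ^ k"
      by (simp add: power_mult mult.commute[of k l] power_divide[symmetric] diff_divide_distrib)
    finally show ?thesis .
  qed
  have "(\<lambda>k. (1 - 1 / 2 ^ l :: real) ^ k) \<longlonglongrightarrow> 0"
  proof (rule LIMSEQ_power_zero)
    have "0 < (1 :: real) / 2 ^ l" "1 / 2 ^ l \<le> (1 :: real)" by simp_all
    then show "norm (1 - 1 / 2 ^ l :: real) < 1"
      unfolding real_norm_def by linarith
  qed
  then have "prob Z \<le> 0"
    using Zle by (intro LIMSEQ_le_const) auto
  then have Zprob: "prob Z = 0"
    by (simp add: measure_le_0_iff)
  have decode: "\<epsilon> n \<omega> = last (fold (shift_map \<phi>) (past k \<omega>) x0)"
    if \<omega>: "\<omega> \<in> space M" and sync: "?sync (past k \<omega>)" for k \<omega>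
  proof -
    let ?m = "n + 1 - int (k * l) - int d"
    have "segment \<epsilon> (n + 1 - int d) d \<omega> = fold (shift_map \<phi>) (past k \<omega>) (segment \<epsilon> ?m d \<omega>)"
      using state_conv_fold_innovations[OF \<omega>, of ?m "k * l"] by (simp add: past_def algebra_simps)
    also have "\<dots> = fold (shift_map \<phi>) (past k \<omega>) x0"
      using sync x0 state_in_E[OF \<omega>, of ?m d] unfolding synchronizing_def by blast
    finally have eq: "segment \<epsilon> (n + 1 - int d) d \<omega> = fold (shift_map \<phi>) (past k \<omega>) x0" .
    obtain d' where "d = Suc d'" using d by (cases d) auto
    then have "last (segment \<epsilon> (n + 1 - int d) d \<omega>) = \<epsilon> n \<omega>"
      by (simp add: segment_Suc)
    with eq show ?thesis by simp
  qed
  have "\<epsilon> n -` {s} \<inter> space M \<in> sets ?F" for s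
  proof -
    let ?A = "\<lambda>k. {\<omega> \<in> space M. ?sync (past k \<omega>) \<and> last (fold (shift_map \<phi>) (past k \<omega>) x0) = s}"
    let ?N = "{\<omega> \<in> space M. last (segment \<epsilon> n 1 \<omega>) = s} \<inter> Z"
    have "\<epsilon> n -` {s} \<inter> space M = (\<Union>k. ?A k) \<union> ?N"
      using decode by (auto simp: Z_def segment_def)
    moreover have "(\<Union>k. ?A k) \<in> sets ?F"
      using pastF[of "\<lambda>u. ?sync u \<and> last (fold (shift_map \<phi>) u x0) = s"]
      by (intro sets.countable_UN) auto
    moreover have "?N \<in> sets ?F"
    proof (rule null_sets_in_completed_sigma)
      have "Z \<in> null_sets M"
        using ZM Zprob by (intro null_setsI) (simp_all add: emeasure_eq_measure)
      then show "?N \<in> null_sets M"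
        using segment_event_measurable[OF measurable_coin] by (intro null_set_Int1) auto
    qed
    ultimately show ?thesis by auto
  qed
  then show ?thesis
    using coin_in_signs by (subst measurable_count_space_eq2) (auto simp: signs_def)
qed

section \<open>Recovering the coins forces accordability\<close>

text \<open>Let \<open>a\<close> and \<open>b\<close> be not accordable and fix any word \<open>w\<close> of innovations in the window.  Started
  from \<open>a\<close> and from \<open>b\<close>, the state reached at time \<open>-1\<close> is different, whereas an event of the window
  cannot tell the two cases apart.  Hence the approximation of the event that the state is
  the one reached from \<open>a\<close> fails in one of the two cases.  Both have
  conditional probability \<open>1 / 2 ^ d\<close> given \<open>w\<close>, so the approximation errors cannot become small.\<close>

lemma accordable_if_states_measurable:
  assumes meas: "\<And>c. c \<in> E d \<Longrightarrow> {\<omega> \<in> space M. segment \<epsilon> (- int d) d \<omega> = c}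
      \<in> completed_sigma_field M (count_space signs) innovation"
    and a: "a \<in> E d" and b: "b \<in> E d"
  shows "accordable \<phi> a b"
proof (rule ccontr)
  assume nacc: "\<not> accordable \<phi> a b"
  let ?A = "\<lambda>c. {\<omega> \<in> space M. segment \<epsilon> (- int d) d \<omega> = c}"
  \<comment> \<open>The errors for the \<open>2 ^ d\<close> states have to add up to less than \<open>1 / 2 ^ d\<close>.\<close>
  let ?\<delta> = "1 / (2 ^ d * 2 ^ d) :: real"
  have innM: "innovation i \<in> measurable M (count_space signs)" for i
    by (rule measurable_innovation[OF measurable_coin refl])
  have "\<forall>c\<in>E d. \<exists>N B D. window_event M innovation N B \<and> D \<in> sets M \<and> prob D < ?\<delta> \<and>
      ?A c - B \<subseteq> D \<and> B - ?A c \<subseteq> D"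
    using completed_sigma_field_approximation[OF innM meas] by simp
  then obtain N B D where
    "\<forall>c\<in>E d. window_event M innovation (N c) (B c) \<and> D c \<in> sets M \<and>
      prob (D c) < ?\<delta> \<and> ?A c - B c \<subseteq> D c \<and> B c - ?A c \<subseteq> D c"
    unfolding bchoice_iff by (elim exE) (rule that)
  note NBD = this[rule_format]
  define n where "n = (\<Sum>c\<in>E d. N c)"
  \<comment> \<open>The window starts right after the state at \<open>?m\<close>.  Its first \<open>n\<close> innovations lead to the state at
    the times \<open>- d, \<dots>, - 1\<close>; the other \<open>n\<close> come later and are fixed only to determine window events.\<close>
  let ?m = "- int n - int d" and ?L = "n + n"
  have win: "window_event M innovation n (B c)" if "c \<in> E d" for c
    using NBD[OF that] that unfolding n_def
    by (auto intro!: window_event_mono[of _ _ "N c"] member_le_sum finite_E)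
  let ?D = "\<Union>c\<in>E d. D c"
  have DM: "?D \<in> sets M" using NBD by (intro sets.finite_UN finite_E) auto
  have "\<exists>x\<in>{a, b}. start_event ?m x w \<subseteq> ?D" if w: "w \<in> E ?L" for w
  proof -
    let ?c = "\<lambda>x. fold (shift_map \<phi>) (take n w) x"
    have lw: "length w = ?L" using w by (simp add: E_def)
    have tw: "set (take n w) \<subseteq> signs"
      using w set_take_subset[of n w] by (auto simp: E_def)
    have ne: "?c a \<noteq> ?c b" using nacc tw by (auto simp: accordable_def)
    have cE: "?c a \<in> E d" by (rule fold_shift_map_E[OF \<phi> d a tw])
    have state: "segment \<epsilon> (- int d) d \<omega> = ?c x" if "\<omega> \<in> start_event ?m x w" for \<omega> x
    proof -
      from that have *: "\<omega> \<in> space M" "segment \<epsilon> ?m d \<omega> = x"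
        "segment innovation (- int n) (n + n) \<omega> = w"
        by (auto simp: start_event_def lw)
      then have "segment innovation (- int n) n \<omega> = take n w"
        by (auto simp: segment_add)
      then show ?thesis
        using state_conv_fold_innovations[OF *(1), of ?m n] * by simp
    qed
    have same: "\<omega>' \<in> B (?c a)" if "\<omega> \<in> B (?c a)" "\<omega> \<in> start_event ?m x w"
      "\<omega>' \<in> start_event ?m x' w" for \<omega> \<omega>' x x'
    proof -
      have "innovation i \<omega> = innovation i \<omega>'" if i: "- int n \<le> i" "i < int n" for i
      proof -
        have "segment innovation (- int n) ?L \<omega> = segment innovation (- int n) ?L \<omega>'"
          using \<open>\<omega> \<in> start_event ?m x w\<close> \<open>\<omega>' \<in> start_event ?m x' w\<close>
          by (simp add: start_event_def lw)
        then have "\<forall>k<?L. innovation (- int n + int k) \<omega> = innovation (- int n + int k) \<omega>'"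
          by (auto simp: segment_def)
        from this[rule_format, of "nat (i + int n)"] show ?thesis using i by simp
      qed
      moreover have "\<omega>' \<in> space M" using that by (simp add: start_event_def)
      ultimately show ?thesis using win[OF cE] that(1) unfolding window_event_def by blast
    qed
    show ?thesis
    proof (cases "\<exists>\<omega> x. \<omega> \<in> B (?c a) \<and> \<omega> \<in> start_event ?m x w")
      case True
      then have "start_event ?m b w \<subseteq> B (?c a)" using same by blast
      moreover have "start_event ?m b w \<inter> ?A (?c a) = {}" using state ne by fastforce
      ultimately have "start_event ?m b w \<subseteq> D (?c a)" using NBD[OF cE] by blast
      then show ?thesis using cE by blast
    next
      case False
      moreover have "start_event ?m a w \<subseteq> ?A (?c a)"
        using state by (auto simp: start_event_def)
      ultimately have "start_event ?m a w \<subseteq> D (?c a)" using NBD[OF cE] by blast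
      then show ?thesis using cE by blast
    qed
  qed
  then obtain x where x: "\<And>w. w \<in> E ?L \<Longrightarrow> x w \<in> {a, b} \<and> start_event ?m (x w) w \<subseteq> ?D"
    by metis
  have xE: "x w \<in> E d" if "w \<in> E ?L" for w using x[OF that] a b by auto
  have "1 / 2 ^ d = (\<Sum>w\<in>E ?L. 1 / 2 ^ (d + ?L) :: real)"
    by (simp add: card_E power_add)
  also have "\<dots> = (\<Sum>w\<in>E ?L. prob (start_event ?m (x w) w))"
    using start_event_prob(2)[OF xE] by (intro sum.cong) auto
  also have "\<dots> = prob (\<Union>w\<in>E ?L. start_event ?m (x w) w)"
  proof (intro finite_measure_finite_Union[symmetric] finite_E)
    show "(\<lambda>w. start_event ?m (x w) w) ` E ?L \<subseteq> sets M"
      using start_event_prob(1)[OF xE] by auto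
    show "disjoint_family_on (\<lambda>w. start_event ?m (x w) w) (E ?L)"
      by (auto simp: disjoint_family_on_def start_event_def E_def)
  qed
  also have "\<dots> \<le> prob ?D"
    using x by (intro finite_measure_mono DM) blast
  also have "\<dots> \<le> (\<Sum>c\<in>E d. prob (D c))"
    using NBD by (intro finite_measure_subadditive_finite finite_E) auto
  also have "\<dots> < (\<Sum>c\<in>E d. ?\<delta>)"
    using NBD a by (intro sum_strict_mono finite_E) auto
  also have "\<dots> = 1 / 2 ^ d"
    by (simp add: card_E)
  finally show False by simp
qed

lemma completed_sigma_fields_eq_imp_accordable:
  assumes eq: "completed_sigma_field M (count_space signs) innovation
      = completed_sigma_field M (count_space signs) \<epsilon>"
    and "a \<in> E d" "b \<in> E d"
  shows "accordable \<phi> a b"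
proof (rule accordable_if_states_measurable[OF _ assms(2,3)])
  fix c
  show "{\<omega> \<in> space M. segment \<epsilon> (- int d) d \<omega> = c}
      \<in> completed_sigma_field M (count_space signs) innovation"
    using segment_event_measurable[OF measurable_completed_sigma[where X = \<epsilon>, OF measurable_coin],
        where P = "\<lambda>u. u = c" and m = "- int d" and L = d]
    by (simp add: eq sets_completed_sigma)
qed

lemma simultaneously_accordable_imp_completed_sigma_fields_eq:
  assumes "simultaneously_accordable \<phi> (E d)"
  shows "completed_sigma_field M (count_space signs) innovation
      = completed_sigma_field M (count_space signs) \<epsilon>"
proof
  show "completed_sigma_field M (count_space signs) innovation
      \<subseteq> completed_sigma_field M (count_space signs) \<epsilon>"
    by (intro completed_sigma_field_subset measurable_innovation
        measurable_completed_sigma measurable_coin space_completed_sigma)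
  show "completed_sigma_field M (count_space signs) \<epsilon>
      \<subseteq> completed_sigma_field M (count_space signs) innovation"
    by (intro completed_sigma_field_subset coin_measurable_innovations assms)
qed

end

section \<open>The equivalence\<close>

theorem theorem11:
  fixes M :: "'a measure"
    and d :: nat
    and \<phi> :: "int list \<Rightarrow> int"
    and \<epsilon> :: "int \<Rightarrow> 'a \<Rightarrow> int"
  assumes "prob_space M"
    and "d \<ge> 1"
    and "\<phi> \<in> E d \<rightarrow> signs"
    and "coin_tossing M \<epsilon>"
  defines "H \<equiv> predictor d \<phi> \<epsilon>"
  shows "(completed_sigma_field M (count_space signs) (\<lambda>n \<omega>. H n \<omega> * \<epsilon> n \<omega>)
            = completed_sigma_field M (count_space signs) \<epsilon>
          \<longleftrightarrow> (\<forall>a\<in>E d. \<forall>b\<in>E d. accordable \<phi> a b))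
       \<and> ((\<forall>a\<in>E d. \<forall>b\<in>E d. accordable \<phi> a b)
          \<longleftrightarrow> simultaneously_accordable \<phi> (E d))"
proof -
  interpret prob_space M by fact
  interpret predicted_coin_tossing M d \<phi> \<epsilon>
    by unfold_locales fact+
  have inn: "(\<lambda>n \<omega>. H n \<omega> * \<epsilon> n \<omega>) = innovation"
    by (simp add: fun_eq_iff innovation_def H_def)
  have "accordable \<phi> a b"
    if "simultaneously_accordable \<phi> (E d)" "a \<in> E d" "b \<in> E d" for a b
    using that unfolding simultaneously_accordable_def accordable_def by blast
  then show ?thesis
    unfolding inn
    using pairwise_imp_simultaneously_accordable[OF \<open>\<phi> \<in> E d \<rightarrow> signs\<close> \<open>d \<ge> 1\<close>]
      completed_sigma_fields_eq_imp_accordable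
      simultaneously_accordable_imp_completed_sigma_fields_eq
    by blast
qed

end
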